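(* Let $\Omega \subseteq \mathbb{C}^n$ be a bounded domain, let $K$ be its Bergman kernel, and let $\mathcal{B}(z,\zeta) = |K(z,\zeta)|^2 / K(z,z)$ be its Poisson-Bergman kernel. If $f \in C(\overline{\Omega})$ is holomorphic on $\Omega$, then $$f(z) = \int_{\Omega} \mathcal{B}(z,\zeta)\, f(\zeta)\, dV(\zeta)$$ for all $z \in \Omega$.
   Context: A domain is a connected open set, and $dV$ is standard Euclidean volume (Lebesgue) measure. The Bergman space $A^2(\Omega)$ is the Hilbert space of holomorphic functions $f$ on $\Omega$ with $\int_\Omega |f|^2\, dV < \infty$, with inner product $\langle f,g\rangle = \int_\Omega f\,\overline{g}\, dV$. Point evaluations are bounded on $A^2(\Omega)$, and the Bergman kernel $K(z,\zeta) = K_\Omega(z,\zeta)$ is its reproducing kernel: for each $z\in\Omega$ the function $\zeta \mapsto \overline{K(z,\zeta)}$ belongs to $A^2(\Omega)$ and $f(z) = \int_\Omega K(z,\zeta) f(\zeta)\, dV(\zeta)$ for all $f \in A^2(\Omega)$. One has $K(z,z) > 0$ for all $z \in \Omega$ when $\Omega$ is bounded. *)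

theory Defs
  imports "HOL-Analysis.Analysis"
begin

text \<open>
  Complex \<open>n\<close>-space is \<^typ>\<open>complex ^ 'n\<close>, on which \<^const>\<open>lborel\<close> is the standard Euclidean volume
  of real \<open>2n\<close>-space. The complex scalar action on it is \<^const>\<open>vector_scalar_mult\<close> (written \<open>*s\<close>).
\<close>

text \<open>
  Holomorphy on an open subset of complex \<open>n\<close>-space: the real Frechet derivative exists at
  every point and is complex linear.
\<close>

definition holomorphic_on_vec :: "(complex ^ 'n \<Rightarrow> complex) \<Rightarrow> (complex ^ 'n) set \<Rightarrow> bool"
  where "holomorphic_on_vec f \<Omega> \<longleftrightarrow>
    (\<forall>z\<in>\<Omega>. \<exists>f'. (f has_derivative f') (at z) \<and> (\<forall>c v. f' (c *s v) = c * f' v))"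

definition bergman_space :: "(complex ^ 'n) set \<Rightarrow> (complex ^ 'n \<Rightarrow> complex) set"
  where "bergman_space \<Omega> =
    {f. holomorphic_on_vec f \<Omega> \<and> set_integrable lborel \<Omega> (\<lambda>\<zeta>. (cmod (f \<zeta>))\<^sup>2)}"

text \<open>
  The reproducing property determines \<open>K\<close> on \<open>\<Omega> \<times> \<Omega>\<close>; values of \<open>K\<close> elsewhere are
  unconstrained and irrelevant. The integrand below is a product of two functions that are square
  integrable on \<open>\<Omega>\<close>, so the integral is never the default value of a divergent one.
\<close>

definition is_bergman_kernel ::
    "(complex ^ 'n) set \<Rightarrow> (complex ^ 'n \<Rightarrow> complex ^ 'n \<Rightarrow> complex) \<Rightarrow> bool"
  where "is_bergman_kernel \<Omega> K \<longleftrightarrow>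
    (\<forall>z\<in>\<Omega>. (\<lambda>\<zeta>. cnj (K z \<zeta>)) \<in> bergman_space \<Omega> \<and>
      (\<forall>f\<in>bergman_space \<Omega>. f z = (LINT \<zeta>:\<Omega>|lborel. K z \<zeta> * f \<zeta>)))"

definition poisson_bergman_kernel ::
    "(complex ^ 'n \<Rightarrow> complex ^ 'n \<Rightarrow> complex) \<Rightarrow> complex ^ 'n \<Rightarrow> complex ^ 'n \<Rightarrow> complex"
  where "poisson_bergman_kernel K z \<zeta> = complex_of_real ((cmod (K z \<zeta>))\<^sup>2) / K z z"

end

theory Submission
  imports Defs
begin

text \<open>
  Since \<open>f\<close> is bounded, \<open>\<zeta> \<mapsto> f \<zeta> * cnj (K z \<zeta>)\<close> lies in the Bergman space; the reproducing property
  applied to it at the point \<open>z\<close> is the claim multiplied by \<open>K z z\<close>. That \<open>K z z\<close> is real and equals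
  the squared norm of \<open>K z\<close> is the case \<open>f = 1\<close>. It is nonzero, since otherwise \<open>K z\<close> would vanish
  almost everywhere and could not reproduce the constant function \<open>1\<close>.
\<close>

lemma holomorphic_on_vec_const: "holomorphic_on_vec (\<lambda>_. c) S"
  unfolding holomorphic_on_vec_def by (auto intro!: exI[of _ "\<lambda>_. 0"])

lemma holomorphic_on_vec_mult:
  assumes "holomorphic_on_vec f S" "holomorphic_on_vec g S"
  shows "holomorphic_on_vec (\<lambda>z. f z * g z) S"
  unfolding holomorphic_on_vec_def
proof
  fix z assume "z \<in> S"
  with assms obtain f' g' where
    "(f has_derivative f') (at z)" "\<And>c v. f' (c *s v) = c * f' v"
    "(g has_derivative g') (at z)" "\<And>c v. g' (c *s v) = c * g' v"
    unfolding holomorphic_on_vec_def by metis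
  then show "\<exists>h'. ((\<lambda>z. f z * g z) has_derivative h') (at z) \<and> (\<forall>c v. h' (c *s v) = c * h' v)"
    by (intro exI[of _ "\<lambda>h. f z * g' h + f' h * g z"])
      (auto intro: has_derivative_mult simp: algebra_simps)
qed

lemma holomorphic_on_vec_imp_continuous_on:
  "holomorphic_on_vec f S \<Longrightarrow> continuous_on S f"
  unfolding holomorphic_on_vec_def
  by (meson continuous_at_imp_continuous_on has_derivative_continuous)

text \<open>Holomorphy says nothing about values off \<open>S\<close>, so measurability is obtained
  only after cutting off by the indicator of \<open>S\<close>. It feeds both domination arguments
  below.\<close>

lemma set_borel_measurable_lborel_continuous_on_open:
  fixes f :: "'a::euclidean_space \<Rightarrow> 'b::real_normed_vector"
  assumes "open S" "continuous_on S f"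
  shows "set_borel_measurable lborel S f"
  using borel_measurable_continuous_on_indicator[of S f] assms
  by (simp add: set_borel_measurable_def)

text \<open>A bounded set has finite volume.\<close>

lemma const_in_bergman_space:
  assumes "open S" "bounded S"
  shows "(\<lambda>_. c) \<in> bergman_space S"
  using assms emeasure_bounded_finite[of S]
  by (auto simp: bergman_space_def holomorphic_on_vec_const set_integrable_def)

text \<open>Square integrability follows by domination by
  \<open>M\<^sup>2 * (cmod (g z))\<^sup>2\<close>.\<close>

lemma bounded_mult_in_bergman_space:
  assumes "open S" and f: "holomorphic_on_vec f S" and M: "\<And>z. z \<in> S \<Longrightarrow> cmod (f z) \<le> M"
    and g: "g \<in> bergman_space S"
  shows "(\<lambda>z. f z * g z) \<in> bergman_space S"
proof -
  have hol: "holomorphic_on_vec (\<lambda>z. f z * g z) S"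
    using f g by (auto simp: bergman_space_def intro: holomorphic_on_vec_mult)
  have "set_integrable lborel S (\<lambda>z. (cmod (f z * g z))\<^sup>2)"
  proof (rule set_integrable_bound)
    show "set_integrable lborel S (\<lambda>z. M\<^sup>2 * (cmod (g z))\<^sup>2)"
      using g by (auto simp: bergman_space_def)
    have "continuous_on S (\<lambda>z. (cmod (f z * g z))\<^sup>2)"
      by (intro continuous_intros holomorphic_on_vec_imp_continuous_on[OF hol, simplified])
    then show "set_borel_measurable lborel S (\<lambda>z. (cmod (f z * g z))\<^sup>2)"
      by (intro set_borel_measurable_lborel_continuous_on_open \<open>open S\<close>)
    show "AE z in lborel. z \<in> S \<longrightarrow> norm ((cmod (f z * g z))\<^sup>2) \<le> norm (M\<^sup>2 * (cmod (g z))\<^sup>2)"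
      using M by (auto simp: norm_mult power_mult_distrib intro!: mult_right_mono power_mono)
  qed
  with hol show ?thesis by (simp add: bergman_space_def)
qed

lemma bergman_kernel_reproducing:
  assumes "is_bergman_kernel S K" "z \<in> S" "g \<in> bergman_space S"
  shows "g z = (LINT \<zeta>:S|lborel. K z \<zeta> * g \<zeta>)"
  using assms by (auto simp: is_bergman_kernel_def)

lemma bergman_kernel_diagonal:
  assumes "is_bergman_kernel S K" "z \<in> S"
  shows "K z z = complex_of_real (LINT \<zeta>:S|lborel. (cmod (K z \<zeta>))\<^sup>2)"
proof -
  have "cnj (K z z) = (LINT \<zeta>:S|lborel. K z \<zeta> * cnj (K z \<zeta>))"
    using assms bergman_kernel_reproducing[OF assms, of "\<lambda>\<zeta>. cnj (K z \<zeta>)"]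
    by (simp add: is_bergman_kernel_def)
  also have "\<dots> = complex_of_real (LINT \<zeta>:S|lborel. (cmod (K z \<zeta>))\<^sup>2)"
    by (simp add: complex_norm_square[symmetric] set_integral_complex_of_real flip: of_real_power)
  finally show ?thesis by (metis complex_cnj_cnj complex_cnj_complex_of_real)
qed

lemma bergman_kernel_diagonal_nonzero:
  assumes "open S" "bounded S" and K: "is_bergman_kernel S K" and z: "z \<in> S"
  shows "K z z \<noteq> 0"
proof
  assume "K z z = 0"
  then have "(LINT \<zeta>:S|lborel. (cmod (K z \<zeta>))\<^sup>2) = 0"
    using bergman_kernel_diagonal[OF K z] by simp
  \<comment> \<open>Integrability rules out that the zero integral is merely the default value of a
    divergent one.\<close>
  moreover have "set_integrable lborel S (\<lambda>\<zeta>. (cmod (K z \<zeta>))\<^sup>2)"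
    using K z by (auto simp: is_bergman_kernel_def bergman_space_def)
  ultimately have "AE \<zeta> in lborel. indicator S \<zeta> *\<^sub>R (cmod (K z \<zeta>))\<^sup>2 = 0"
    unfolding set_lebesgue_integral_def set_integrable_def
    by (subst (asm) integral_nonneg_eq_0_iff_AE) auto
  then have "AE \<zeta> in lborel. indicator S \<zeta> *\<^sub>R (K z \<zeta> * 1) = 0"
    by eventually_elim (auto simp: indicator_def)
  then have "(LINT \<zeta>:S|lborel. K z \<zeta> * 1) = 0"
    unfolding set_lebesgue_integral_def by (rule integral_eq_zero_AE)
  moreover have "1 = (LINT \<zeta>:S|lborel. K z \<zeta> * 1)"
    using bergman_kernel_reproducing[OF K z const_in_bergman_space[OF assms(1,2), of 1]] .
  ultimately show False by simp
qed

theorem proposition3p2: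
  fixes \<Omega> :: "(complex ^ 'n) set"
    and K :: "complex ^ 'n \<Rightarrow> complex ^ 'n \<Rightarrow> complex"
    and f :: "complex ^ 'n \<Rightarrow> complex"
  assumes "open \<Omega>" and "connected \<Omega>" and "bounded \<Omega>"
    and "is_bergman_kernel \<Omega> K"
    and "continuous_on (closure \<Omega>) f"
    and "holomorphic_on_vec f \<Omega>"
  shows "\<forall>z\<in>\<Omega>.
    set_integrable lborel \<Omega> (\<lambda>\<zeta>. poisson_bergman_kernel K z \<zeta> * f \<zeta>) \<and>
    f z = (LINT \<zeta>:\<Omega>|lborel. poisson_bergman_kernel K z \<zeta> * f \<zeta>)"
proof
  fix z assume z: "z \<in> \<Omega>"
  let ?k = "\<lambda>\<zeta>. cnj (K z \<zeta>)"
  \<comment> \<open>The numerator of the Poisson-Bergman integrand; the factor \<open>K z z\<close>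
    does not depend on \<open>\<zeta>\<close> and is divided out at the end.\<close>
  let ?h = "\<lambda>\<zeta>. complex_of_real ((cmod (K z \<zeta>))\<^sup>2) * f \<zeta>"
  have k: "?k \<in> bergman_space \<Omega>"
    using assms(4) z by (auto simp: is_bergman_kernel_def)
  have "compact (f ` closure \<Omega>)"
    using assms(3,5) by (intro compact_continuous_image) auto
  then obtain M where M: "\<And>\<zeta>. \<zeta> \<in> \<Omega> \<Longrightarrow> cmod (f \<zeta>) \<le> M"
    using closure_subset by (fastforce dest!: compact_imp_bounded simp: bounded_iff)
  have "set_integrable lborel \<Omega> ?h"
  proof (rule set_integrable_bound)
    show "set_integrable lborel \<Omega> (\<lambda>\<zeta>. M * (cmod (K z \<zeta>))\<^sup>2)"
      using k by (auto simp: bergman_space_def)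
    have "continuous_on \<Omega> f" "continuous_on \<Omega> ?k"
      using k assms(6) by (auto simp: bergman_space_def intro: holomorphic_on_vec_imp_continuous_on)
    \<comment> \<open>Continuity is known for the conjugate \<open>?k\<close>, which has the same
      modulus as \<open>K z\<close>.\<close>
    then have "continuous_on \<Omega> (\<lambda>\<zeta>. complex_of_real ((cmod (?k \<zeta>))\<^sup>2) * f \<zeta>)"
      by (intro continuous_on_mult continuous_on_of_real continuous_on_power continuous_on_norm)
    then show "set_borel_measurable lborel \<Omega> ?h"
      using set_borel_measurable_lborel_continuous_on_open[OF \<open>open \<Omega>\<close>] by simp
    show "AE \<zeta> in lborel. \<zeta> \<in> \<Omega> \<longrightarrow> norm (?h \<zeta>) \<le> norm (M * (cmod (K z \<zeta>))\<^sup>2)"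
    proof (intro AE_I2 impI)
      fix \<zeta> assume "\<zeta> \<in> \<Omega>"
      then show "norm (?h \<zeta>) \<le> norm (M * (cmod (K z \<zeta>))\<^sup>2)"
        \<comment> \<open>No sign of \<open>M\<close> was recorded, so the bound passes through its
          absolute value.\<close>
        using mult_right_mono[OF order_trans[OF M abs_ge_self], of \<zeta> "(cmod (K z \<zeta>))\<^sup>2"]
        by (simp add: norm_mult norm_power abs_mult mult.commute)
    qed
  qed
  moreover have "(\<lambda>\<zeta>. f \<zeta> * ?k \<zeta>) \<in> bergman_space \<Omega>"
    using bounded_mult_in_bergman_space[OF assms(1,6) M k] by simp
  then have "f z * ?k z = (LINT \<zeta>:\<Omega>|lborel. K z \<zeta> * (f \<zeta> * ?k \<zeta>))"
    by (rule bergman_kernel_reproducing[OF assms(4) z])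
  \<comment> \<open>\<open>K z z\<close> is real, hence equal to \<open>?k z\<close>, and under the
    integral \<open>K z \<zeta> * ?k \<zeta>\<close> is the squared modulus.\<close>
  then have "f z * K z z = (LINT \<zeta>:\<Omega>|lborel. ?h \<zeta>)"
    using bergman_kernel_diagonal[OF assms(4) z]
    by (metis (no_types, lifting) ext complex_norm_square complex_cnj_complex_of_real mult.assoc mult.commute of_real_power)
  ultimately show "set_integrable lborel \<Omega> (\<lambda>\<zeta>. poisson_bergman_kernel K z \<zeta> * f \<zeta>) \<and>
    f z = (LINT \<zeta>:\<Omega>|lborel. poisson_bergman_kernel K z \<zeta> * f \<zeta>)"
    using bergman_kernel_diagonal_nonzero[OF assms(1,3,4) z]
    by (simp add: poisson_bergman_kernel_def field_simps)
qed

end
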